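(* Let $\{T_\theta\}_{\theta\in U}$ satisfy the standing assumptions (i)–(iv) of the context, let $\{\theta_\varepsilon^{c}\}_{\varepsilon\downarrow 0}$ be a center family, and let $\{\mathcal S_\varepsilon\}_{\varepsilon\downarrow0}\subset\mathcal H$ be a slow region family of $\{\theta_\varepsilon^{c}\}_{\varepsilon\downarrow0}$ with vanishing modulus $\rho_\varepsilon$. Fix $\beta\in(0,1)$ and define $N_\varepsilon:=\big\lfloor(1-\beta)\sqrt{m_U/M_U}\cdot\rho_\varepsilon^{-1}\big\rfloor$. Then $N_\varepsilon\to\infty$ as $\varepsilon\downarrow0$, and (for all sufficiently small $\varepsilon$) $$\mathrm{dist}_{\mathcal H}\big((T_\varepsilon^{c})^k(z),V_\varepsilon^{c}\big)\ \ge\ \sqrt{m_U/M_U}\,\beta\cdot\mathrm{dist}_{\mathcal H}(z,V_\varepsilon^{c}),\qquad\forall z\in\mathcal S_\varepsilon,\ 0\le k\le N_\varepsilon .$$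
   Context: **Setting.** $\mathcal X,\mathcal Y,\mathcal H$ are finite-dimensional real Hilbert spaces, $\mathcal K\subseteq\mathcal X$ is a closed convex cone with dual cone $\mathcal K^*$. A parameter is $\theta=(\mathcal A,b,c)\in\mathcal D:=\mathcal L(\mathcal X,\mathcal Y)\times\mathcal Y\times\mathcal X$ (with $\mathcal L(\mathcal X,\mathcal Y)$ the linear maps), normed by $\|\theta\|_{\mathcal D}^2:=\|\mathcal A\|_{\mathrm{HS}}^2+\|b\|_{\mathcal Y}^2+\|c\|_{\mathcal X}^2$. Put $\mathrm{KKT}(\theta):=\{(x,y,s):\mathcal Ax=b,\ \mathcal A^*y+s=c,\ \langle x,s\rangle_{\mathcal X}=0,\ x\in\mathcal K,\ s\in\mathcal K^*\}$ and $\mathcal D_{\mathrm{KKT}}:=\{\theta\in\mathcal D:\mathrm{KKT}(\theta)\ne\emptyset\}$. Let $\bar\theta\in\mathrm{cl}(\mathcal D_{\mathrm{KKT}})$ and let $U\subset\mathcal D$ be compact with $\bar\theta\in U$. To each $\theta\in U$ is associated a map $T_\theta:\mathcal H\to\mathcal H$, with residual map $\delta_\theta:=T_\theta-\mathrm{Id}$ and fixed point set $\mathrm{Fix}(T_\theta)$. **Standing assumptions.** (i) For every $\theta\in U$: $\mathrm{Fix}(T_\theta)\ne\emptyset$ iff $\theta\in\mathcal D_{\mathrm{KKT}}$. (ii) For every $\theta\in U$, $T_\theta$ is $\alpha_\theta$-averaged for some $\alpha_\theta\in(0,1)$ (i.e. $T_\theta=(1-\alpha_\theta)\mathrm{Id}+\alpha_\theta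 N_\theta$ with $N_\theta$ nonexpansive) with respect to the inner product $\langle z,w\rangle_\theta:=\langle z,G_\theta w\rangle_{\mathcal H}$, $G_\theta$ self-adjoint positive definite on $\mathcal H$. (iii) There are $0<m_U\le M_U<\infty$ with $m_U\mathrm{Id}\preceq G_\theta\preceq M_U\mathrm{Id}$ for all $\theta\in U$. (iv) There is $L_U(r)=a+a'r$ with $a,a'\ge0$ such that $\|T_\theta z-T_{\theta'}z\|_{\mathcal H}\le L_U(\|z\|_{\mathcal H})\,\|\theta-\theta'\|_{\mathcal D}$ for all $\theta,\theta'\in U$, $z\in\mathcal H$. **Families.** All conditions on families indexed by $\varepsilon\downarrow0$ are required only for all sufficiently small $\varepsilon>0$. A center family is $\{\theta_\varepsilon^{c}\}_{\varepsilon\downarrow0}\subset U\cap\mathcal D_{\mathrm{KKT}}$ with $\theta_\varepsilon^{c}\to\bar\theta$. Write $T_\varepsilon^{c}:=T_{\theta_\varepsilon^{c}}$, $\delta_\varepsilon^{c}:=\delta_{\theta_\varepsilon^{c}}$, $V_\varepsilon^{c}:=\mathrm{Fix}(T_\varepsilon^{c})$. $\mathrm{dist}_{\mathcal H}$ is the distance in $\|\cdot\|_{\mathcal H}$. **Slow region (SR) family.** A set family $\{\mathcal S_\varepsilon\}_{\varepsilon\downarrow0}$ of subsets of $\mathcal H$ is an SR family of $\{\theta_\varepsilon^{c}\}$ iff (1) $\mathcal S_\varepsilon\ne\emptyset$ and $\mathcal S_\varepsilon\cap V_\varepsilon^{c}=\emptyset$; (2) its vanishing modulus $\rho_\varepsilon:=\sup_{z\in\mathcal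 S_\varepsilon}\|\delta_\varepsilon^{c}(z)\|_{\mathcal H}/\mathrm{dist}_{\mathcal H}(z,V_\varepsilon^{c})$ is finite and $\rho_\varepsilon\to0$ as $\varepsilon\downarrow0$. *)

theory Defs
  imports "HOL-Analysis.Analysis"
begin

section \<open>Parameters of the conic program\<close>

text \<open>
  A parameter \<open>\<theta> = (A, b, c)\<close>. In finite dimensions every linear map is bounded, so
  \<open>'x \<Rightarrow>\<^sub>L 'y\<close> is the space of all linear maps.
\<close>

type_synonym ('x, 'y) param = "('x \<Rightarrow>\<^sub>L 'y) \<times> 'y \<times> 'x"

definition hs_norm :: "('x::euclidean_space \<Rightarrow>\<^sub>L 'y::euclidean_space) \<Rightarrow> real" where
  "hs_norm A = sqrt (\<Sum>e\<in>Basis. (norm (blinfun_apply A e))\<^sup>2)"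

definition param_norm :: "('x::euclidean_space, 'y::euclidean_space) param \<Rightarrow> real" where
  "param_norm \<theta> = (case \<theta> of (A, b, c) \<Rightarrow> sqrt ((hs_norm A)\<^sup>2 + (norm b)\<^sup>2 + (norm c)\<^sup>2))"

text \<open>
  The library norm on \<open>param\<close> uses the operator norm for the first component. By the following
  bounds it is equivalent to \<^const>\<open>param_norm\<close>, so compactness, closure and convergence in the
  library topology are those of \<^const>\<open>param_norm\<close>.
\<close>

lemma norm_le_hs_norm:
  fixes A :: "'x::euclidean_space \<Rightarrow>\<^sub>L 'y::euclidean_space"
  shows "norm A \<le> hs_norm A"
proof (rule norm_blinfun_bound)
  show "0 \<le> hs_norm A" by (simp add: hs_norm_def sum_nonneg)
  fix x :: 'x
  have "blinfun_apply A x = (\<Sum>e\<in>Basis. (x \<bullet> e) *\<^sub>R blinfun_apply A e)"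
    by (subst euclidean_representation[symmetric, of x])
      (simp add: blinfun.sum_right blinfun.scaleR_right)
  then have "norm (blinfun_apply A x) \<le> (\<Sum>e\<in>Basis. norm ((x \<bullet> e) *\<^sub>R blinfun_apply A e))"
    by (simp only: norm_sum)
  also have "\<dots> = (\<Sum>e\<in>Basis. \<bar>norm (blinfun_apply A e)\<bar> * \<bar>x \<bullet> e\<bar>)"
    by (simp add: mult.commute)
  also have "\<dots> \<le> L2_set (\<lambda>e. norm (blinfun_apply A e)) Basis * L2_set (\<lambda>e. x \<bullet> e) Basis"
    by (rule L2_set_mult_ineq)
  also have "\<dots> = hs_norm A * norm x"
    by (simp add: hs_norm_def L2_set_def norm_eq_sqrt_inner euclidean_inner[of x x] power2_eq_square)
  finally show "norm (blinfun_apply A x) \<le> hs_norm A * norm x" .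
qed

lemma hs_norm_le:
  fixes A :: "'x::euclidean_space \<Rightarrow>\<^sub>L 'y::euclidean_space"
  shows "hs_norm A \<le> sqrt DIM('x) * norm A"
proof -
  have "(\<Sum>e\<in>Basis. (norm (blinfun_apply A e))\<^sup>2) \<le> (\<Sum>e\<in>(Basis::'x set). (norm A)\<^sup>2)"
  proof (intro sum_mono power_mono)
    fix e :: 'x assume "e \<in> Basis"
    then show "norm (blinfun_apply A e) \<le> norm A"
      using norm_blinfun[of A e] by simp
  qed simp
  then show ?thesis
    unfolding hs_norm_def
    using real_sqrt_le_mono by (fastforce simp: real_sqrt_mult)
qed

lemma norm_le_param_norm:
  fixes \<theta> :: "('x::euclidean_space, 'y::euclidean_space) param"
  shows "norm \<theta> \<le> param_norm \<theta>"
proof (cases \<theta>)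
  case (fields A b c)
  have "(norm A)\<^sup>2 \<le> (hs_norm A)\<^sup>2"
    by (intro power_mono norm_le_hs_norm) simp
  then show ?thesis
    by (simp add: fields param_norm_def norm_Pair)
qed

lemma param_norm_le:
  fixes \<theta> :: "('x::euclidean_space, 'y::euclidean_space) param"
  shows "param_norm \<theta> \<le> sqrt DIM('x) * norm \<theta>"
proof (cases \<theta>)
  case (fields A b c)
  have "0 \<le> hs_norm A" by (simp add: hs_norm_def sum_nonneg)
  then have 1: "(hs_norm A)\<^sup>2 \<le> DIM('x) * (norm A)\<^sup>2"
    using power_mono[OF hs_norm_le[of A], of 2] by (simp add: power_mult_distrib)
  have d: "1 \<le> real DIM('x)"
    using DIM_positive[where 'a='x] by linarith
  have 2: "(norm b)\<^sup>2 \<le> DIM('x) * (norm b)\<^sup>2" "(norm c)\<^sup>2 \<le> DIM('x) * (norm c)\<^sup>2"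
    using mult_right_mono[OF d, of "(norm b)\<^sup>2"] mult_right_mono[OF d, of "(norm c)\<^sup>2"] by simp_all
  have "sqrt ((hs_norm A)\<^sup>2 + (norm b)\<^sup>2 + (norm c)\<^sup>2)
      \<le> sqrt (DIM('x) * ((norm A)\<^sup>2 + ((norm b)\<^sup>2 + (norm c)\<^sup>2)))"
    using 1 2 by (intro real_sqrt_le_mono) (simp add: distrib_left)
  then show ?thesis
    by (simp add: fields param_norm_def norm_Pair real_sqrt_mult)
qed

section \<open>KKT points\<close>

definition dual_cone :: "'x::real_inner set \<Rightarrow> 'x set" where
  "dual_cone K = {s. \<forall>x\<in>K. 0 \<le> x \<bullet> s}"

definition KKT :: "'x::euclidean_space set \<Rightarrow> ('x, 'y::euclidean_space) param \<Rightarrow> ('x \<times> 'y \<times> 'x) set"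
  where "KKT K \<theta> = (case \<theta> of (A, b, c) \<Rightarrow>
    {(x, y, s). blinfun_apply A x = b \<and> adjoint (blinfun_apply A) y + s = c \<and>
                x \<bullet> s = 0 \<and> x \<in> K \<and> s \<in> dual_cone K})"

definition D_KKT :: "'x::euclidean_space set \<Rightarrow> ('x, 'y::euclidean_space) param set" where
  "D_KKT K = {\<theta>. KKT K \<theta> \<noteq> {}}"

section \<open>Fixed points, residuals and averaged maps\<close>

definition Fix :: "('h \<Rightarrow> 'h) \<Rightarrow> 'h set" where
  "Fix T = {z. T z = z}"

definition residual :: "('h::real_vector \<Rightarrow> 'h) \<Rightarrow> 'h \<Rightarrow> 'h" where
  "residual T z = T z - z"

definition self_adjoint_pos_def :: "('h::euclidean_space \<Rightarrow> 'h) \<Rightarrow> bool" where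
  "self_adjoint_pos_def G \<longleftrightarrow> linear G \<and> adjoint G = G \<and> (\<forall>z. z \<noteq> 0 \<longrightarrow> 0 < z \<bullet> G z)"

definition loewner_le :: "('h::real_inner \<Rightarrow> 'h) \<Rightarrow> ('h \<Rightarrow> 'h) \<Rightarrow> bool" where
  "loewner_le F G \<longleftrightarrow> (\<forall>z. z \<bullet> F z \<le> z \<bullet> G z)"

definition weighted_norm :: "('h::real_inner \<Rightarrow> 'h) \<Rightarrow> 'h \<Rightarrow> real" where
  "weighted_norm G z = sqrt (z \<bullet> G z)"

definition nonexpansive_wrt :: "('h::real_inner \<Rightarrow> 'h) \<Rightarrow> ('h \<Rightarrow> 'h) \<Rightarrow> bool" where
  "nonexpansive_wrt G N \<longleftrightarrow> (\<forall>z w. weighted_norm G (N z - N w) \<le> weighted_norm G (z - w))"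

definition averaged_wrt :: "('h::real_inner \<Rightarrow> 'h) \<Rightarrow> real \<Rightarrow> ('h \<Rightarrow> 'h) \<Rightarrow> bool" where
  "averaged_wrt G \<alpha> T \<longleftrightarrow>
     (\<exists>N. nonexpansive_wrt G N \<and> (\<forall>z. T z = (1 - \<alpha>) *\<^sub>R z + \<alpha> *\<^sub>R N z))"

section \<open>Families indexed by \<open>\<epsilon> \<down> 0\<close>\<close>

text \<open>
  Families are functions of a real \<open>\<epsilon>\<close>; the filter \<open>at_right 0\<close> expresses both
  ``for all sufficiently small \<open>\<epsilon> > 0\<close>'' and limits as \<open>\<epsilon> \<down> 0\<close>.
\<close>

definition center_family ::
  "'x::euclidean_space set \<Rightarrow> ('x, 'y::euclidean_space) param set \<Rightarrow> ('x, 'y) param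
    \<Rightarrow> (real \<Rightarrow> ('x, 'y) param) \<Rightarrow> bool" where
  "center_family K U \<theta>bar \<theta>c \<longleftrightarrow>
     (\<forall>\<^sub>F \<epsilon> in at_right 0. \<theta>c \<epsilon> \<in> U \<inter> D_KKT K) \<and> (\<theta>c \<longlongrightarrow> \<theta>bar) (at_right 0)"

definition residual_ratio :: "('h::euclidean_space \<Rightarrow> 'h) \<Rightarrow> 'h \<Rightarrow> real" where
  "residual_ratio T z = norm (residual T z) / infdist z (Fix T)"

text \<open>A real supremum, meaningful only together with the finiteness requirement
  \<^const>\<open>bdd_above\<close> in \<open>slow_region_family\<close> below.\<close>

definition vanishing_modulus :: "('h::euclidean_space \<Rightarrow> 'h) \<Rightarrow> 'h set \<Rightarrow> real" where
  "vanishing_modulus T S = (SUP z\<in>S. residual_ratio T z)"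

definition slow_region_family ::
  "('p \<Rightarrow> 'h::euclidean_space \<Rightarrow> 'h) \<Rightarrow> (real \<Rightarrow> 'p) \<Rightarrow> (real \<Rightarrow> 'h set) \<Rightarrow> bool" where
  "slow_region_family T \<theta>c S \<longleftrightarrow>
     (\<forall>\<^sub>F \<epsilon> in at_right 0.
        S \<epsilon> \<noteq> {} \<and> S \<epsilon> \<inter> Fix (T (\<theta>c \<epsilon>)) = {} \<and>
        bdd_above (residual_ratio (T (\<theta>c \<epsilon>)) ` S \<epsilon>)) \<and>
     ((\<lambda>\<epsilon>. vanishing_modulus (T (\<theta>c \<epsilon>)) (S \<epsilon>)) \<longlongrightarrow> 0) (at_right 0)"

end

theory Submission
  imports Defs
begin

text \<open>
  A map that is averaged for a weighted norm is nonexpansive for it, so the successive displacements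
  \<open>T\<^sup>j\<^sup>+\<^sup>1 z - T\<^sup>j z\<close> never grow in that norm. Passing from the weighted to the ambient norm and back
  costs the factor \<open>L = sqrt (M / m)\<close> only once, whatever the number of iterations: every iterate of
  \<open>T\<close> is \<open>L\<close>-Lipschitz (\<open>averaged_iterate_lipschitz\<close>). Each step therefore moves the orbit of \<open>z\<close> by at
  most \<open>L\<close> times the initial residual, and \<open>k\<close> steps bring it closer to the fixed point set by at
  most \<open>k * L * norm (residual T z)\<close> (\<open>infdist_iterate_ge\<close>). On a slow region the residual is at
  most \<open>\<rho> * infdist z (Fix T)\<close>, and \<open>N \<epsilon>\<close> is the largest \<open>k\<close> with \<open>k * L * \<rho> \<le> 1 - \<beta>\<close>. The
  distance to the fixed point set thus keeps the fraction \<open>\<beta>\<close> of its initial value, which is at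
  least \<open>sqrt (m / M) * \<beta>\<close> of it.

  The divergence of \<open>N\<close> requires \<open>\<rho> \<epsilon>\<close> to be strictly positive, because division by zero yields zero.
  This holds because the fixed point set is nonempty and, \<open>T\<close> being continuous, closed: a point of
  the slow region then has positive distance to it as well as a nonzero residual.
\<close>

text \<open>
  Expanding \<open>x \<mapsto> x \<bullet> G x\<close> at a convex combination gives the convex combination of the values minus
  \<open>\<alpha> (1 - \<alpha>)\<close> times the value at the difference, as for a squared norm. That
  last value is nonnegative, so the form is convex.
\<close>

lemma quadratic_form_convex:
  fixes G :: "'h::real_inner \<Rightarrow> 'h" and u v :: 'h
  assumes "linear G" and pos: "\<And>z. 0 \<le> z \<bullet> G z" and \<alpha>: "0 \<le> \<alpha>" "\<alpha> \<le> 1"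
  defines "w \<equiv> (1 - \<alpha>) *\<^sub>R u + \<alpha> *\<^sub>R v"
  shows "w \<bullet> G w \<le> (1 - \<alpha>) * (u \<bullet> G u) + \<alpha> * (v \<bullet> G v)"
proof -
  interpret linear G by fact
  have "w \<bullet> G w = (1 - \<alpha>) * (u \<bullet> G u) + \<alpha> * (v \<bullet> G v) - \<alpha> * (1 - \<alpha>) * ((u - v) \<bullet> G (u - v))"
    by (simp add: w_def add diff scaleR inner_add_left inner_add_right inner_diff_left inner_diff_right
        algebra_simps)
  moreover have "0 \<le> \<alpha> * (1 - \<alpha>) * ((u - v) \<bullet> G (u - v))"
    using \<alpha> pos by simp
  ultimately show ?thesis by simp
qed

lemma averaged_imp_nonexpansive:
  assumes G: "linear G" "\<And>z. 0 \<le> z \<bullet> G z" and \<alpha>: "0 \<le> \<alpha>" "\<alpha> \<le> 1"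
    and T: "averaged_wrt G \<alpha> T"
  shows "nonexpansive_wrt G T"
  unfolding nonexpansive_wrt_def
proof (intro allI)
  fix z w
  obtain N where N: "nonexpansive_wrt G N" and TN: "\<And>z. T z = (1 - \<alpha>) *\<^sub>R z + \<alpha> *\<^sub>R N z"
    using T unfolding averaged_wrt_def by blast
  have "T z - T w = (1 - \<alpha>) *\<^sub>R (z - w) + \<alpha> *\<^sub>R (N z - N w)"
    by (simp add: TN algebra_simps)
  then have "(T z - T w) \<bullet> G (T z - T w)
      \<le> (1 - \<alpha>) * ((z - w) \<bullet> G (z - w)) + \<alpha> * ((N z - N w) \<bullet> G (N z - N w))"
    using quadratic_form_convex[OF G \<alpha>] by simp
  also have "\<dots> \<le> (1 - \<alpha>) * ((z - w) \<bullet> G (z - w)) + \<alpha> * ((z - w) \<bullet> G (z - w))"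
    using N \<alpha> by (simp add: nonexpansive_wrt_def weighted_norm_def mult_left_mono)
  also have "\<dots> = (z - w) \<bullet> G (z - w)"
    by (simp add: algebra_simps)
  finally show "weighted_norm G (T z - T w) \<le> weighted_norm G (z - w)"
    by (simp add: weighted_norm_def)
qed

lemma nonexpansive_iterate:
  assumes "nonexpansive_wrt G T"
  shows "nonexpansive_wrt G (T ^^ k)"
proof (induction k)
  case (Suc k)
  then show ?case
    using assms unfolding nonexpansive_wrt_def by (simp, blast intro: order_trans)
qed (simp add: nonexpansive_wrt_def)

lemma nonexpansive_imp_lipschitz:
  assumes lower: "loewner_le (\<lambda>z. m *\<^sub>R z) G" and upper: "loewner_le G (\<lambda>z. M *\<^sub>R z)"
    and m: "0 < m" and F: "nonexpansive_wrt G F"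
  shows "norm (F z - F w) \<le> sqrt (M / m) * norm (z - w)"
proof -
  have "sqrt m * norm (F z - F w) = sqrt (m * ((F z - F w) \<bullet> (F z - F w)))"
    by (simp add: real_sqrt_mult norm_eq_sqrt_inner)
  also have "\<dots> \<le> weighted_norm G (F z - F w)"
    using lower by (simp add: loewner_le_def weighted_norm_def)
  also have "\<dots> \<le> weighted_norm G (z - w)"
    using F by (simp add: nonexpansive_wrt_def)
  also have "\<dots> \<le> sqrt (M * ((z - w) \<bullet> (z - w)))"
    using upper by (simp add: loewner_le_def weighted_norm_def)
  also have "\<dots> = sqrt M * norm (z - w)"
    by (simp add: real_sqrt_mult norm_eq_sqrt_inner)
  finally show ?thesis
    using m by (simp add: real_sqrt_divide field_simps)
qed

text \<open>
  The Lipschitz constant does not depend on \<open>k\<close>: the weighted norm absorbs the iteration,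
  and the two norms are compared only at its start and its end.
\<close>

lemma averaged_iterate_lipschitz:
  assumes "linear G" and lower: "loewner_le (\<lambda>z. m *\<^sub>R z) G" and upper: "loewner_le G (\<lambda>z. M *\<^sub>R z)"
    and m: "0 < m" and \<alpha>: "0 \<le> \<alpha>" "\<alpha> \<le> 1" and T: "averaged_wrt G \<alpha> T"
  shows "norm ((T ^^ k) z - (T ^^ k) w) \<le> sqrt (M / m) * norm (z - w)"
proof -
  have "0 \<le> z \<bullet> G z" for z
  proof -
    have "0 \<le> m * (z \<bullet> z)" using m by simp
    also have "\<dots> \<le> z \<bullet> G z" using lower by (simp add: loewner_le_def)
    finally show ?thesis .
  qed
  then have "nonexpansive_wrt G (T ^^ k)"
    using \<open>linear G\<close> \<alpha> T by (intro nonexpansive_iterate averaged_imp_nonexpansive)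
  then show ?thesis
    by (rule nonexpansive_imp_lipschitz[OF lower upper m])
qed

lemma norm_iterate_diff_le:
  fixes T :: "'h::euclidean_space \<Rightarrow> 'h"
  assumes lip: "\<And>k z w. norm ((T ^^ k) z - (T ^^ k) w) \<le> L * norm (z - w)"
  shows "norm ((T ^^ k) z - z) \<le> k * (L * norm (residual T z))"
proof (induction k)
  case (Suc k)
  have "norm ((T ^^ Suc k) z - z)
      \<le> norm ((T ^^ k) (T z) - (T ^^ k) z) + norm ((T ^^ k) z - z)"
    using norm_triangle_ineq[of "(T ^^ k) (T z) - (T ^^ k) z" "(T ^^ k) z - z"]
    by (simp add: funpow_swap1)
  also have "\<dots> \<le> L * norm (residual T z) + k * (L * norm (residual T z))"
    using lip[of k "T z" z] Suc.IH by (simp add: residual_def)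
  finally show ?case by (simp add: algebra_simps)
qed simp

lemma infdist_iterate_ge:
  fixes T :: "'h::euclidean_space \<Rightarrow> 'h"
  assumes "\<And>k z w. norm ((T ^^ k) z - (T ^^ k) w) \<le> L * norm (z - w)"
  shows "infdist z V - k * (L * norm (residual T z)) \<le> infdist ((T ^^ k) z) V"
  using norm_iterate_diff_le[of T L k z, OF assms] infdist_triangle[of z V "(T ^^ k) z"]
  by (simp add: dist_norm norm_minus_commute)

lemma closed_Fix:
  fixes T :: "'h::euclidean_space \<Rightarrow> 'h"
  assumes "continuous_on UNIV T"
  shows "closed (Fix T)"
  unfolding Fix_def using assms by (intro closed_Collect_eq continuous_on_id)

lemma residual_ratio_pos:
  assumes "closed (Fix T)" "Fix T \<noteq> {}" "z \<notin> Fix T"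
  shows "0 < residual_ratio T z" and "0 < infdist z (Fix T)"
proof -
  show dist: "0 < infdist z (Fix T)"
    using assms by (simp add: infdist_pos_not_in_closed)
  have "residual T z \<noteq> 0"
    using assms(3) by (simp add: residual_def Fix_def)
  then show "0 < residual_ratio T z"
    using dist by (simp add: residual_ratio_def)
qed

text \<open>
  The situation at a single parameter, with \<open>L\<close> a common Lipschitz constant of all iterates. The
  hypothesis on \<open>k\<close> says that the orbit has moved by at most the fraction \<open>1 - \<beta>\<close> of the initial
  distance.
\<close>

lemma slow_region_distance:
  fixes T :: "'h::euclidean_space \<Rightarrow> 'h"
  assumes lip: "\<And>k z w. norm ((T ^^ k) z - (T ^^ k) w) \<le> L * norm (z - w)" and L: "0 \<le> L"
    and "Fix T \<noteq> {}" "S \<inter> Fix T = {}" and bdd: "bdd_above (residual_ratio T ` S)" and z: "z \<in> S"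
  shows "0 < vanishing_modulus T S"
    and "k * L * vanishing_modulus T S \<le> 1 - \<beta> \<Longrightarrow> \<beta> * infdist z (Fix T) \<le> infdist ((T ^^ k) z) (Fix T)"
proof -
  let ?d = "infdist z (Fix T)" and ?\<rho> = "vanishing_modulus T S"
  have "L-lipschitz_on UNIV T"
    using lip[of 1] L by (intro lipschitz_onI) (simp_all add: dist_norm)
  then have "closed (Fix T)"
    by (intro closed_Fix lipschitz_on_continuous_on)
  then have pos: "0 < residual_ratio T z" "0 < ?d"
    using residual_ratio_pos assms by blast+
  have ratio: "residual_ratio T z \<le> ?\<rho>"
    unfolding vanishing_modulus_def using z bdd by (rule cSUP_upper)
  with pos show "0 < ?\<rho>" by linarith
  have res: "norm (residual T z) \<le> ?\<rho> * ?d"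
    using ratio pos(2) by (simp add: residual_ratio_def divide_le_eq)
  assume k: "k * L * ?\<rho> \<le> 1 - \<beta>"
  have "k * (L * norm (residual T z)) \<le> k * (L * (?\<rho> * ?d))"
    using res L by (intro mult_left_mono) simp_all
  also have "\<dots> = (k * L * ?\<rho>) * ?d"
    by simp
  also have "\<dots> \<le> (1 - \<beta>) * ?d"
    using k pos(2) by (intro mult_right_mono) simp_all
  finally have "\<beta> * ?d \<le> ?d - k * (L * norm (residual T z))"
    by (simp add: algebra_simps)
  also have "\<dots> \<le> infdist ((T ^^ k) z) (Fix T)"
    by (rule infdist_iterate_ge) (rule lip)
  finally show "\<beta> * ?d \<le> infdist ((T ^^ k) z) (Fix T)" .
qed

theorem proposition2p4:
  fixes K :: "'x::euclidean_space set"
    and U :: "('x, 'y::euclidean_space) param set"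
    and \<theta>bar :: "('x, 'y) param"
    and T :: "('x, 'y) param \<Rightarrow> 'h::euclidean_space \<Rightarrow> 'h"
    and G :: "('x, 'y) param \<Rightarrow> 'h \<Rightarrow> 'h"
    and m M a a' \<beta> :: real
    and \<theta>c :: "real \<Rightarrow> ('x, 'y) param"
    and S :: "real \<Rightarrow> 'h set"
    and \<rho> :: "real \<Rightarrow> real"
    and N :: "real \<Rightarrow> nat"
  assumes K: "closed K" "convex K" "cone K" "K \<noteq> {}"
    and \<theta>bar: "\<theta>bar \<in> closure (D_KKT K)"
    and U: "compact U" "\<theta>bar \<in> U"
    and fix_iff: "\<forall>\<theta>\<in>U. Fix (T \<theta>) \<noteq> {} \<longleftrightarrow> \<theta> \<in> D_KKT K"
    and G: "\<forall>\<theta>\<in>U. self_adjoint_pos_def (G \<theta>)"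
    and averaged: "\<forall>\<theta>\<in>U. \<exists>\<alpha>. 0 < \<alpha> \<and> \<alpha> < 1 \<and> averaged_wrt (G \<theta>) \<alpha> (T \<theta>)"
    and mM: "0 < m" "m \<le> M"
    and G_bounds: "\<forall>\<theta>\<in>U. loewner_le (\<lambda>z. m *\<^sub>R z) (G \<theta>) \<and> loewner_le (G \<theta>) (\<lambda>z. M *\<^sub>R z)"
    and aa': "0 \<le> a" "0 \<le> a'"
    and lipschitz: "\<forall>\<theta>\<in>U. \<forall>\<theta>'\<in>U. \<forall>z.
          norm (T \<theta> z - T \<theta>' z) \<le> (a + a' * norm z) * param_norm (\<theta> - \<theta>')"
    and center: "center_family K U \<theta>bar \<theta>c"
    and slow: "slow_region_family T \<theta>c S"
    and \<rho>: "\<rho> = (\<lambda>\<epsilon>. vanishing_modulus (T (\<theta>c \<epsilon>)) (S \<epsilon>))"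
    and \<beta>: "0 < \<beta>" "\<beta> < 1"
    and N: "N = (\<lambda>\<epsilon>. nat \<lfloor>(1 - \<beta>) * sqrt (m / M) * inverse (\<rho> \<epsilon>)\<rfloor>)"
  shows "filterlim N at_top (at_right 0) \<and>
    (\<forall>\<^sub>F \<epsilon> in at_right 0. \<forall>z\<in>S \<epsilon>. \<forall>k\<le>N \<epsilon>.
       infdist ((T (\<theta>c \<epsilon>) ^^ k) z) (Fix (T (\<theta>c \<epsilon>)))
         \<ge> sqrt (m / M) * \<beta> * infdist z (Fix (T (\<theta>c \<epsilon>))))"
proof
  let ?T = "\<lambda>\<epsilon>. T (\<theta>c \<epsilon>)"
  let ?L = "sqrt (M / m)"
  let ?slow = "\<lambda>\<epsilon>. S \<epsilon> \<noteq> {} \<and> S \<epsilon> \<inter> Fix (?T \<epsilon>) = {} \<and> bdd_above (residual_ratio (?T \<epsilon>) ` S \<epsilon>)"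
  have slow_ev: "\<forall>\<^sub>F \<epsilon> in at_right 0. ?slow \<epsilon>" and \<rho>_lim: "(\<rho> \<longlongrightarrow> 0) (at_right 0)"
    using slow by (simp_all add: slow_region_family_def \<rho>)
  have center_ev: "\<forall>\<^sub>F \<epsilon> in at_right 0. \<theta>c \<epsilon> \<in> U \<inter> D_KKT K"
    using center by (simp add: center_family_def)

  have lip: "norm ((T \<theta> ^^ k) z - (T \<theta> ^^ k) w) \<le> ?L * norm (z - w)" if "\<theta> \<in> U" for \<theta> k z w
  proof -
    obtain \<alpha> where "0 < \<alpha>" "\<alpha> < 1" "averaged_wrt (G \<theta>) \<alpha> (T \<theta>)"
      using averaged \<open>\<theta> \<in> U\<close> by blast
    moreover have "linear (G \<theta>)"
      using G \<open>\<theta> \<in> U\<close> by (simp add: self_adjoint_pos_def_def)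
    ultimately show ?thesis
      using G_bounds \<open>\<theta> \<in> U\<close> mM(1) by (intro averaged_iterate_lipschitz[where G = "G \<theta>" and \<alpha> = \<alpha>]) auto
  qed
  have L: "0 \<le> ?L" using mM by simp

  have \<rho>_pos: "\<forall>\<^sub>F \<epsilon> in at_right 0. 0 < \<rho> \<epsilon>"
    using slow_ev center_ev
  proof eventually_elim
    case (elim \<epsilon>)
    then obtain z where "z \<in> S \<epsilon>" by blast
    then show ?case
      unfolding \<rho> using elim fix_iff by (intro slow_region_distance(1)[OF lip L]) auto
  qed

  have const: "0 < (1 - \<beta>) * sqrt (m / M)"
    using \<beta> mM by simp
  have "filterlim (\<lambda>\<epsilon>. (1 - \<beta>) * sqrt (m / M) * inverse (\<rho> \<epsilon>)) at_top (at_right 0)"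
    by (intro filterlim_tendsto_pos_mult_at_top[OF tendsto_const const]
        filterlim_inverse_at_top \<rho>_lim \<rho>_pos)
  then show "filterlim N at_top (at_right 0)"
    unfolding N
    by (intro filterlim_compose[OF filterlim_nat_sequentially]
        filterlim_compose[OF filterlim_floor_sequentially])

  show "\<forall>\<^sub>F \<epsilon> in at_right 0. \<forall>z\<in>S \<epsilon>. \<forall>k\<le>N \<epsilon>.
       infdist ((?T \<epsilon> ^^ k) z) (Fix (?T \<epsilon>)) \<ge> sqrt (m / M) * \<beta> * infdist z (Fix (?T \<epsilon>))"
    using slow_ev center_ev \<rho>_pos
  proof eventually_elim
    case (elim \<epsilon>)
    show ?case
    proof (intro ballI allI impI)
      fix z k assume z: "z \<in> S \<epsilon>" and k: "k \<le> N \<epsilon>"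
      have "real k \<le> (1 - \<beta>) * sqrt (m / M) * inverse (\<rho> \<epsilon>)"
      proof -
        have "0 \<le> (1 - \<beta>) * sqrt (m / M) * inverse (\<rho> \<epsilon>)"
          using const \<open>0 < \<rho> \<epsilon>\<close> by simp
        then have "real (N \<epsilon>) \<le> (1 - \<beta>) * sqrt (m / M) * inverse (\<rho> \<epsilon>)"
          unfolding N by (rule of_nat_floor)
        with k show ?thesis by linarith
      qed
      then have "k * ?L * \<rho> \<epsilon> \<le> ((1 - \<beta>) * sqrt (m / M) * inverse (\<rho> \<epsilon>)) * ?L * \<rho> \<epsilon>"
        using L \<open>0 < \<rho> \<epsilon>\<close> by (intro mult_right_mono) simp_all
      also have "\<dots> = 1 - \<beta>"
        using mM \<open>0 < \<rho> \<epsilon>\<close> by (simp add: real_sqrt_divide)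
      finally have "\<beta> * infdist z (Fix (?T \<epsilon>)) \<le> infdist ((?T \<epsilon> ^^ k) z) (Fix (?T \<epsilon>))"
        unfolding \<rho> using elim fix_iff z by (intro slow_region_distance(2)[OF lip L]) auto
      moreover have "sqrt (m / M) * (\<beta> * infdist z (Fix (?T \<epsilon>))) \<le> 1 * (\<beta> * infdist z (Fix (?T \<epsilon>)))"
        using mM \<beta> by (intro mult_right_mono) (simp_all add: infdist_nonneg)
      ultimately show "sqrt (m / M) * \<beta> * infdist z (Fix (?T \<epsilon>)) \<le> infdist ((?T \<epsilon> ^^ k) z) (Fix (?T \<epsilon>))"
        by (simp add: mult.assoc)
    qed
  qed
qed

end
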